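(* Let $\mathbb{X}$ be a linearly ordered radicable idempotent semifield with zero $0_{\mathbb{X}}$ and one $1_{\mathbb{X}}$, and let $n\ge 1$. Let $A\in\mathbb{X}^{n\times n}$ be a matrix with spectral radius $\lambda>0_{\mathbb{X}}$, let $p,q,g,h\in\mathbb{X}^{n}$ be vectors such that $q$ and $h$ are regular and $h^{-}g\leq 1_{\mathbb{X}}$, and let $r\in\mathbb{X}$. Consider the problem of finding regular vectors $x\in\mathbb{X}^{n}$ that $$ \text{minimize}\quad x^{-}Ax\oplus x^{-}p\oplus q^{-}x\oplus r,\qquad \text{subject to}\quad g\leq x\leq h . $$ Then the minimum in this problem (over all regular $x$ with $g\le x\le h$) is equal to $$ \mu=\lambda\oplus\bigoplus_{m=0}^{n-1}(q^{-}A^{m}p)^{1/(m+2)}\oplus\bigoplus_{m=0}^{n-1}(q^{-}A^{m}g\oplus h^{-}A^{m}p)^{1/(m+1)}\oplus\bigoplus_{m=1}^{n-1}(h^{-}A^{m}g)^{1/m}\oplus r, $$ and all regular solutions are given by $$ x=(\mu^{-1}A)^{\ast}u, $$ where the vector $u\in\mathbb{X}^n$ satisfies the condition $$ \mu^{-1}p\oplus g\leq u\leq\bigl((\mu^{-1}q^{-}\oplus h^{-})(\mu^{-1}A)^{\ast}\bigr)^{-}. $$ That is, a regular vector $x$ is a solution of the problem (it is feasible and attains the minimum $\mu$) if and only if $x=(\mu^{-1}A)^{\ast}u$ for some vector $u$ satisfying this condition.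
   Context: Idempotent semifield: a set $\mathbb{X}$ with two distinct elements $0_{\mathbb{X}}$ (zero) and $1_{\mathbb{X}}$ (one) and operations $\oplus$ (addition) and $\otimes$ (multiplication, sign omitted), such that $(\mathbb{X},0_{\mathbb{X}},\oplus)$ is a commutative monoid with $x\oplus x=x$ for all $x$, $(\mathbb{X}\setminus\{0_{\mathbb{X}}\},1_{\mathbb{X}},\otimes)$ is a commutative group, multiplication distributes over addition, and $0_{\mathbb{X}}$ is absorbing for multiplication. The order is $x\leq y$ iff $x\oplus y=y$; it is assumed to be total (linearly ordered). All inequalities and the word "minimize" refer to this order. The inverse of $x\ne 0_{\mathbb{X}}$ is $x^{-1}$. Integer powers are multiplicative powers, with $0_{\mathbb{X}}^{p}=0_{\mathbb{X}}$ for $p>0$. The semifield is radicable: for every $x$ and every integer $p>0$ the root $x^{1/p}$ exists (the element $y$ with $y^{p}=x$), so rational exponents are defined. Matrices and vectors: $\mathbb{X}^{m\times n}$ is the set of $m\times n$ matrices and $\mathbb{X}^{n}$ the set of column vectors. Matrix sums, products and multiplication by scalars follow the usual rules with $\oplus,\otimes$ in place of $+,\times$; inequalities are entry-wise. A vector is regular if it has no entry equal to $0_{\mathbb{X}}$. For a nonzero column vector $x=(x_i)$, $x^{-}$ is the row vector with entries $x_i^{-1}$ if $x_i\neq 0_{\mathbb{X}}$ and $0_{\mathbb{X}}$ otherwise; likewise, for a nonzero row vector $y$, $y^{-}$ is the column vector defined by the same entry-wise rule. $I$ is the identity matrix ($1_{\mathbb{X}}$ on the diagonal, $0_{\mathbb{X}}$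 elsewhere), $A^{0}=I$, $A^{p}=A^{p-1}A$. The trace is $\operatorname{tr}A=a_{11}\oplus\cdots\oplus a_{nn}$. The spectral radius of $A\in\mathbb{X}^{n\times n}$ is its maximal eigenvalue, given by $\lambda=\operatorname{tr}A\oplus\operatorname{tr}^{1/2}(A^{2})\oplus\cdots\oplus\operatorname{tr}^{1/n}(A^{n})$, where $\operatorname{tr}^{1/m}(A^m)=(\operatorname{tr}(A^m))^{1/m}$. For an $n\times n$ matrix $B$ with $\operatorname{tr}B\oplus\cdots\oplus\operatorname{tr}B^{n}\leq 1_{\mathbb{X}}$, the asterate (Kleene star) is $B^{\ast}=I\oplus B\oplus\cdots\oplus B^{n-1}$. An empty sum $\bigoplus$ equals $0_{\mathbb{X}}$. *)

theory Defs
  imports "HOL-Analysis.Analysis"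
begin

text \<open>
  The semifield is a type of the following class; \<open>+\<close>, \<open>*\<close>, \<open>0\<close>, \<open>1\<close> are its idempotent addition,
  multiplication, zero and one. The value of \<open>inverse 0\<close> is left unspecified.
\<close>

class linordered_idempotent_semifield = comm_semiring_1 + inverse + linorder +
  assumes add_idem: "x + x = x"
    and left_inverse_semifield: "x \<noteq> 0 \<Longrightarrow> inverse x * x = 1"
    and divide_inverse_semifield: "x / y = x * inverse y"
    and le_iff_add_absorb: "x \<le> y \<longleftrightarrow> x + y = y"

class radicable_linordered_idempotent_semifield = linordered_idempotent_semifield +
  assumes radicable: "p > 0 \<Longrightarrow> \<exists>y. y ^ p = x"

definition sroot :: "nat \<Rightarrow> 'a::radicable_linordered_idempotent_semifield \<Rightarrow> 'a" where
  "sroot p x = (THE y. y ^ p = x)"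

definition regular :: "'a::zero ^ 'n \<Rightarrow> bool" where
  "regular x \<longleftrightarrow> (\<forall>i. x $ i \<noteq> 0)"

text \<open>Row and column vectors share the type \<open>'a ^ 'n\<close>, so this serves for both.\<close>

definition conj_vec :: "'a::linordered_idempotent_semifield ^ 'n \<Rightarrow> 'a ^ 'n"  (\<open>(_\<^sup>-)\<close> [1000] 999) where
  "x\<^sup>- = (\<chi> i. if x $ i \<noteq> 0 then inverse (x $ i) else 0)"

definition smult_mat :: "'a::times \<Rightarrow> 'a ^ 'n ^ 'm \<Rightarrow> 'a ^ 'n ^ 'm"  (infixr \<open>*ms\<close> 75) where
  "c *ms A = map_matrix ((*) c) A"

text \<open>The library's \<open>*\<close> and \<open>^\<close> on matrices act entrywise, hence a separate power for \<open>**\<close>.\<close>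

primrec matpow :: "'a::semiring_1 ^ 'n ^ 'n \<Rightarrow> nat \<Rightarrow> 'a ^ 'n ^ 'n" where
  "matpow A 0 = mat 1"
| "matpow A (Suc p) = matpow A p ** A"

definition asterate :: "'a::semiring_1 ^ 'n ^ 'n \<Rightarrow> 'a ^ 'n ^ 'n" where
  "asterate B = (\<Sum>m<CARD('n). matpow B m)"

definition eigenvalue :: "'a::semiring_1 ^ 'n ^ 'n \<Rightarrow> 'a \<Rightarrow> bool" where
  "eigenvalue A l \<longleftrightarrow> (\<exists>x. x \<noteq> 0 \<and> A *v x = l *s x)"

text \<open>The greatest eigenvalue always exists and is given by the usual trace formula; see
  \<open>spectral_radius_eq\<close> below.\<close>

definition spectral_radius :: "'a::linordered_idempotent_semifield ^ 'n ^ 'n \<Rightarrow> 'a" where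
  "spectral_radius A = (GREATEST l. eigenvalue A l)"

definition objective ::
  "'a::linordered_idempotent_semifield ^ 'n ^ 'n \<Rightarrow> 'a ^ 'n \<Rightarrow> 'a ^ 'n \<Rightarrow> 'a \<Rightarrow> 'a ^ 'n \<Rightarrow> 'a" where
  "objective A p q r x =
     scalar_product (x\<^sup>- v* A) x + scalar_product (x\<^sup>-) p + scalar_product (q\<^sup>-) x + r"

definition feasible ::
  "'a::linordered_idempotent_semifield ^ 'n \<Rightarrow> 'a ^ 'n \<Rightarrow> 'a ^ 'n \<Rightarrow> bool" where
  "feasible g h x \<longleftrightarrow> regular x \<and> g \<le> x \<and> x \<le> h"


subsection \<open>Basic facts\<close>

context linordered_idempotent_semifield
begin

subclass canonically_ordered_monoid_add
proof
  fix a b :: 'a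
  show "a \<le> b \<longleftrightarrow> (\<exists>c. b = a + c)"
    unfolding le_iff_add_absorb by (metis add_idem add.assoc)
qed

subclass ordered_comm_semiring
proof
  fix a b c :: 'a
  assume "a \<le> b"
  then show "c * a \<le> c * b"
    unfolding le_iff_add_absorb by (metis distrib_left)
qed

lemma add_eq_max: "x + y = max x y"
  by (metis le_iff_add_absorb add.commute linear max.absorb1 max.absorb2)

lemma add_le_iff_semifield: "x + y \<le> z \<longleftrightarrow> x \<le> z \<and> y \<le> z"
  by (simp add: add_eq_max)

lemma sum_le_iff_semifield:
  "finite S \<Longrightarrow> sum f S \<le> z \<longleftrightarrow> (\<forall>s\<in>S. f s \<le> z)"
  by (induction S rule: finite_induct) (auto simp: add_le_iff_semifield)

lemma member_le_sum_semifield: "finite S \<Longrightarrow> s \<in> S \<Longrightarrow> f s \<le> sum f S"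
  using sum_le_iff_semifield by blast

lemma sum_attained_semifield:
  "finite S \<Longrightarrow> S \<noteq> {} \<Longrightarrow> \<exists>s\<in>S. sum f S = f s"
  by (induction S rule: finite_ne_induct) (auto simp: add_eq_max max_def)

lemma mult_eq_0_iff_semifield: "x * y = 0 \<longleftrightarrow> x = 0 \<or> y = 0"
proof
  assume "x * y = 0"
  then have "inverse x * x * y = 0" by (simp add: mult.assoc)
  then show "x = 0 \<or> y = 0" using left_inverse_semifield[of x] by (metis mult_1_left)
qed auto

lemma mult_le_cancel_right_semifield:
  assumes "c \<noteq> 0"
  shows "x * c \<le> y * c \<longleftrightarrow> x \<le> y"
proof
  assume "x * c \<le> y * c"
  then have "x * c * inverse c \<le> y * c * inverse c" by (rule mult_right_mono) simp
  moreover have "c * inverse c = 1" using left_inverse_semifield[OF assms] by (simp add: mult.commute)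
  ultimately show "x \<le> y" by (simp add: mult.assoc)
qed (simp add: mult_right_mono)

lemma power_eq_0_iff_semifield: "x ^ m = 0 \<longleftrightarrow> x = 0 \<and> m \<noteq> 0"
  by (induction m) (auto simp: mult_eq_0_iff_semifield)

lemma power_mono_semifield: "x \<le> y \<Longrightarrow> x ^ m \<le> y ^ m"
  by (induction m) (simp_all add: mult_mono)

lemma power_strict_mono_semifield:
  assumes "x < y" "m > 0"
  shows "x ^ m < y ^ m"
  using \<open>m > 0\<close>
proof (induction m rule: nat_induct_non_zero)
  case 1
  then show ?case using assms by simp
next
  case (Suc m)
  have "y \<noteq> 0" using assms(1) zero_le[of x] by auto
  then have y: "y ^ m \<noteq> 0" by (simp add: power_eq_0_iff_semifield)
  have "x * x ^ m \<le> x * y ^ m" using Suc.IH by (intro mult_left_mono) auto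
  also have "\<dots> < y * y ^ m"
    using mult_le_cancel_right_semifield[OF y, of y x] assms(1) by (simp flip: not_le)
  finally show ?case by simp
qed

lemma power_le_iff_semifield: "m > 0 \<Longrightarrow> x ^ m \<le> y ^ m \<longleftrightarrow> x \<le> y"
  using power_mono_semifield[of x y m] power_strict_mono_semifield[of y x m] by (auto simp flip: not_le)

end

lemma sroot_ex1:
  fixes x :: "'a::radicable_linordered_idempotent_semifield"
  assumes "p > 0"
  shows "\<exists>!y. y ^ p = x"
proof -
  have "y = z" if "y ^ p = z ^ p" for y z :: 'a
    using that power_le_iff_semifield[OF assms, of y z] power_le_iff_semifield[OF assms, of z y]
    by (intro order.antisym) auto
  then show ?thesis using radicable[OF assms, of x] by blast
qed

lemma sroot_power:
  fixes x :: "'a::radicable_linordered_idempotent_semifield"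
  assumes "p > 0"
  shows "sroot p x ^ p = x"
  unfolding sroot_def using theI'[OF sroot_ex1[OF assms]] .


subsection \<open>Matrix powers and weights of walks\<close>

lemma matpow_walk_le:
  fixes A :: "'a::linordered_idempotent_semifield ^ 'n ^ 'n"
  shows "(\<Prod>l<k. A $ f l $ f (Suc l)) \<le> matpow A k $ f 0 $ f k"
proof (induction k)
  case 0
  then show ?case by (simp add: mat_def)
next
  case (Suc k)
  have "(\<Prod>l<Suc k. A $ f l $ f (Suc l)) \<le> matpow A k $ f 0 $ f k * A $ f k $ f (Suc k)"
    using Suc by (simp add: mult_right_mono)
  also have "\<dots> \<le> matpow A (Suc k) $ f 0 $ f (Suc k)"
    by (simp add: matrix_matrix_mult_def)
       (rule member_le_sum_semifield[where f = "\<lambda>j. matpow A k $ f 0 $ j * A $ j $ f (Suc k)"], auto)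
  finally show ?case .
qed

lemma matpow_walk_attained:
  fixes A :: "'a::linordered_idempotent_semifield ^ 'n ^ 'n"
  assumes "matpow A k $ i $ j \<noteq> 0"
  shows "\<exists>f. f 0 = i \<and> f k = j \<and> matpow A k $ i $ j = (\<Prod>l<k. A $ f l $ f (Suc l))"
  using assms
proof (induction k arbitrary: j)
  case 0
  then show ?case by (intro exI[of _ "\<lambda>_. i"]) (auto simp: mat_def split: if_splits)
next
  case (Suc k)
  have "\<exists>m\<in>UNIV. matpow A (Suc k) $ i $ j = matpow A k $ i $ m * A $ m $ j"
    by (simp add: matrix_matrix_mult_def)
       (metis sum_attained_semifield[of UNIV "\<lambda>m. matpow A k $ i $ m * A $ m $ j"]
          finite UNIV_not_empty)
  then obtain m where m: "matpow A (Suc k) $ i $ j = matpow A k $ i $ m * A $ m $ j"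
    by blast
  with Suc.prems have "matpow A k $ i $ m \<noteq> 0" by auto
  from Suc.IH[OF this] obtain f where f: "f 0 = i" "f k = m"
    "matpow A k $ i $ m = (\<Prod>l<k. A $ f l $ f (Suc l))" by blast
  show ?case
    by (intro exI[of _ "f(Suc k := j)"]) (use f m in \<open>auto intro!: prod.cong\<close>)
qed

lemma walk_repeats:
  fixes f :: "nat \<Rightarrow> 'n::finite"
  shows "\<exists>s t. s < t \<and> t \<le> CARD('n) \<and> f s = f t"
proof -
  have "card (f ` {..CARD('n)}) < card {..CARD('n)}"
    using card_mono[of UNIV "f ` {..CARD('n)}"] by simp
  then have "\<not> inj_on f {..CARD('n)}" by (rule pigeonhole)
  then show ?thesis
    unfolding inj_on_def by (metis atMost_iff linorder_neqE_nat)
qed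

lemma matpow_diag_le_trace:
  fixes A :: "'a::linordered_idempotent_semifield ^ 'n ^ 'n"
  shows "matpow A m $ i $ i \<le> trace (matpow A m)"
  unfolding trace_def by (rule member_le_sum_semifield[where f = "\<lambda>i. matpow A m $ i $ i"]) auto

lemma matpow_smult:
  fixes A :: "'a::linordered_idempotent_semifield ^ 'n ^ 'n"
  shows "matpow (c *ms A) m = c ^ m *ms matpow A m"
proof (induction m)
  case 0
  then show ?case by (simp add: smult_mat_def vec_eq_iff)
next
  case (Suc m)
  then show ?case
    by (simp add: smult_mat_def vec_eq_iff matrix_matrix_mult_def sum_distrib_left mult_ac)
qed

lemma matpow_reduce:
  fixes B :: "'a::linordered_idempotent_semifield ^ 'n ^ 'n"
  assumes tr: "\<And>m. m \<in> {1..CARD('n)} \<Longrightarrow> trace (matpow B m) \<le> 1"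
  shows "matpow B CARD('n) $ i $ j \<le> asterate B $ i $ j"
proof (cases "matpow B CARD('n) $ i $ j = 0")
  case False
  let ?n = "CARD('n)"
  from matpow_walk_attained[OF False] obtain f where f: "f 0 = i" "f ?n = j"
    "matpow B ?n $ i $ j = (\<Prod>l<?n. B $ f l $ f (Suc l))" by blast
  obtain s t where st: "s < t" "t \<le> ?n" "f s = f t" using walk_repeats[of f] by blast
  let ?w = "\<lambda>f l. B $ f l $ f (Suc l)"
  define g where "g l = (if l \<le> s then f l else f (l + (t - s)))" for l
  have split: "prod h {..<?n} = prod h {..<s} * prod h {s..<t} * prod h {t..<?n}" for h :: "nat \<Rightarrow> 'a"
    using st by (metis atLeast0LessThan le_eq_less_or_eq le_trans zero_le prod.atLeastLessThan_concat)
  have mid: "prod (?w f) {s..<t} \<le> 1"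
  proof -
    have "prod (?w f) {s..<t} = (\<Prod>l<t - s. ?w (\<lambda>l. f (l + s)) l)"
      using st prod.shift_bounds_nat_ivl[of "?w f" 0 s "t - s"] by (simp add: atLeast0LessThan)
    also have "\<dots> \<le> matpow B (t - s) $ f s $ f s"
      using matpow_walk_le[of B "\<lambda>l. f (l + s)" "t - s"] st by simp
    also have "\<dots> \<le> trace (matpow B (t - s))"
      by (rule matpow_diag_le_trace)
    also have "\<dots> \<le> 1"
      by (rule tr) (use st in auto)
    finally show ?thesis .
  qed
  have "matpow B ?n $ i $ j = prod (?w f) {s..<t} * (prod (?w f) {..<s} * prod (?w f) {t..<?n})"
    unfolding f(3) split by (simp add: mult_ac)
  also have "\<dots> \<le> 1 * (prod (?w f) {..<s} * prod (?w f) {t..<?n})"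
    by (rule mult_right_mono[OF mid]) simp
  also have "prod (?w f) {..<s} = prod (?w g) {..<s}"
    by (rule prod.cong) (auto simp: g_def)
  also have "prod (?w f) {t..<?n} = prod (?w g) {s..<?n - (t - s)}"
  proof -
    have "prod (?w f) {t..<?n} = (\<Prod>l\<in>{s..<?n - (t - s)}. ?w f (l + (t - s)))"
      using st prod.shift_bounds_nat_ivl[of "?w f" s "t - s" "?n - (t - s)"] by simp
    also have "\<dots> = prod (?w g) {s..<?n - (t - s)}"
      by (rule prod.cong) (use st in \<open>auto simp: g_def\<close>)
    finally show ?thesis .
  qed
  also have "1 * (prod (?w g) {..<s} * prod (?w g) {s..<?n - (t - s)}) = prod (?w g) {..<?n - (t - s)}"
    using st prod.atLeastLessThan_concat[of 0 s "?n - (t - s)" "?w g"]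
    by (simp add: atLeast0LessThan)
  also have "\<dots> \<le> matpow B (?n - (t - s)) $ g 0 $ g (?n - (t - s))"
    by (rule matpow_walk_le)
  also have "g 0 = i" using f by (simp add: g_def)
  also have "g (?n - (t - s)) = j"
    using f st by (cases "t = ?n") (auto simp: g_def)
  also have "matpow B (?n - (t - s)) $ i $ j \<le> asterate B $ i $ j"
    unfolding asterate_def sum_component
    by (rule member_le_sum_semifield[where f = "\<lambda>m. matpow B m $ i $ j"]) (use st in auto)
  finally show ?thesis .
qed simp


subsection \<open>The spectral radius\<close>

definition trace_bound :: "'a::radicable_linordered_idempotent_semifield ^ 'n ^ 'n \<Rightarrow> 'a" where
  "trace_bound A = (\<Sum>m=1..CARD('n). sroot m (trace (matpow A m)))"

lemma matpow_Suc_left: "matpow A (Suc m) = A ** matpow A m"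
  by (induction m) (simp_all flip: matrix_mul_assoc)

lemma trace_le_trace_bound:
  fixes A :: "'a::radicable_linordered_idempotent_semifield ^ 'n ^ 'n"
  assumes "m \<in> {1..CARD('n)}"
  shows "trace (matpow A m) \<le> trace_bound A ^ m"
proof -
  have "sroot m (trace (matpow A m)) \<le> trace_bound A"
    unfolding trace_bound_def
    by (rule member_le_sum_semifield[where f = "\<lambda>m. sroot m (trace (matpow A m))"]) (use assms in auto)
  then have "sroot m (trace (matpow A m)) ^ m \<le> trace_bound A ^ m"
    by (rule power_mono_semifield)
  moreover have "m > 0" using assms by simp
  ultimately show ?thesis by (simp add: sroot_power)
qed

lemma eigenvalue_le_trace_bound:
  fixes A :: "'a::radicable_linordered_idempotent_semifield ^ 'n ^ 'n"
  assumes "eigenvalue A l"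
  shows "l \<le> trace_bound A"
proof (cases "l = 0")
  case False
  obtain x where x: "x \<noteq> 0" "A *v x = l *s x" using assms by (auto simp: eigenvalue_def)
  then obtain i0 where i0: "x $ i0 \<noteq> 0" by (auto simp: vec_eq_iff)
  have "\<exists>j. A $ i $ j * x $ j = l * x $ i" for i
  proof -
    have "(\<Sum>j\<in>UNIV. A $ i $ j * x $ j) = l * x $ i"
      using x(2) by (auto simp: vec_eq_iff matrix_vector_mult_def)
    then show ?thesis
      using sum_attained_semifield[of UNIV "\<lambda>j. A $ i $ j * x $ j"] by auto
  qed
  then obtain nxt where nxt: "\<And>i. A $ i $ nxt i * x $ nxt i = l * x $ i" by metis
  define f where "f k = (nxt ^^ k) i0" for k
  have f: "A $ f k $ f (Suc k) * x $ f (Suc k) = l * x $ f k" for k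
    using nxt by (simp add: f_def)
  have nz: "x $ f k \<noteq> 0" for k
  proof (induction k)
    case 0 then show ?case using i0 by (simp add: f_def)
  next
    case (Suc k) then show ?case using f[of k] False by (metis mult_eq_0_iff_semifield)
  qed
  have walk: "(\<Prod>k<d. A $ f (s + k) $ f (Suc (s + k))) * x $ f (s + d) = l ^ d * x $ f s" for s d
  proof (induction d)
    case (Suc d)
    have "(\<Prod>k<Suc d. A $ f (s + k) $ f (Suc (s + k))) * x $ f (s + Suc d)
        = (\<Prod>k<d. A $ f (s + k) $ f (Suc (s + k))) * (l * x $ f (s + d))"
      using f[of "s + d"] by (simp add: mult.assoc)
    then show ?case using Suc by (simp add: mult_ac)
  qed simp
  obtain s t where st: "s < t" "t \<le> CARD('n)" "f s = f t" using walk_repeats[of f] by blast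
  let ?d = "t - s"
  have d: "?d \<in> {1..CARD('n)}" using st by auto
  have "l ^ ?d * x $ f s = (\<Prod>k<?d. A $ f (s + k) $ f (Suc (s + k))) * x $ f s"
    using walk[where s = s and d = ?d] st by simp
  also have "\<dots> \<le> matpow A ?d $ f s $ f s * x $ f s"
    using matpow_walk_le[of A "\<lambda>k. f (s + k)" ?d] st by (intro mult_right_mono) auto
  also have "\<dots> \<le> trace_bound A ^ ?d * x $ f s"
    using order_trans[OF matpow_diag_le_trace[of A ?d "f s"] trace_le_trace_bound[OF d, of A]]
    by (intro mult_right_mono) auto
  finally have "l ^ ?d \<le> trace_bound A ^ ?d"
    by (simp only: mult_le_cancel_right_semifield[OF nz[of s]])
  then show ?thesis
    using power_le_iff_semifield[of ?d l "trace_bound A"] st by simp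
qed simp

lemma eigenvalue_trace_bound:
  fixes A :: "'a::radicable_linordered_idempotent_semifield ^ 'n ^ 'n"
  shows "eigenvalue A (trace_bound A)"
proof (cases "trace_bound A = 0")
  case True
  have "\<exists>j. \<forall>i. A $ i $ j = 0"
  proof (rule ccontr)
    assume "\<not> ?thesis"
    then obtain prv where prv: "\<And>j. A $ prv j $ j \<noteq> 0" by metis
    define f where "f k = (prv ^^ k) undefined" for k
    obtain s t where st: "s < t" "t \<le> CARD('n)" "f s = f t" using walk_repeats[of f] by blast
    have d: "t - s \<in> {1..CARD('n)}" using st by auto
    have fs: "A $ f (Suc k) $ f k \<noteq> 0" for k using prv by (simp add: f_def)
    have "A $ f (t - l) $ f (t - Suc l) \<noteq> 0" if "l < t - s" for l
    proof -
      have "t - l = Suc (t - Suc l)" using that by simp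
      then show ?thesis using fs by metis
    qed
    then have "(\<Prod>l<m. A $ f (t - l) $ f (t - Suc l)) \<noteq> 0" if "m \<le> t - s" for m
      using that by (induction m) (auto simp: mult_eq_0_iff_semifield)
    then have "(\<Prod>l<t - s. A $ f (t - l) $ f (t - Suc l)) \<noteq> 0" by blast
    moreover have "(\<Prod>l<t - s. A $ f (t - l) $ f (t - Suc l)) \<le> matpow A (t - s) $ f t $ f t"
      using matpow_walk_le[of A "\<lambda>l. f (t - l)" "t - s"] st by simp
    moreover have "matpow A (t - s) $ f t $ f t \<le> trace_bound A ^ (t - s)"
      using matpow_diag_le_trace trace_le_trace_bound[OF d] by (rule order_trans)
    moreover have "trace_bound A ^ (t - s) = 0" using True st by (simp add: power_eq_0_iff_semifield)
    ultimately show False by simp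
  qed
  then obtain c where c: "\<And>i. A $ i $ c = 0" by blast
  have "axis c 1 \<noteq> (0 :: 'a ^ 'n)" by (simp add: vec_eq_iff axis_def)
  moreover have "A *v axis c 1 = trace_bound A *s axis c 1"
    using True c by (simp add: vec_eq_iff matrix_vector_mult_def axis_def if_distrib cong: if_cong)
  ultimately show ?thesis unfolding eigenvalue_def by blast
next
  case False
  let ?n = "CARD('n)" and ?l = "trace_bound A"
  define B where "B = inverse ?l *ms A"
  have inv: "inverse ?l ^ m * ?l ^ m = 1" for m
    using left_inverse_semifield[OF False] by (simp flip: power_mult_distrib)
  have Bm: "matpow B m $ i $ j = inverse ?l ^ m * matpow A m $ i $ j" for m i j
    by (simp add: B_def matpow_smult) (simp add: smult_mat_def)
  have tr: "trace (matpow B m) \<le> 1" if "m \<in> {1..?n}" for m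
  proof -
    have "trace (matpow B m) = inverse ?l ^ m * trace (matpow A m)"
      by (simp add: trace_def Bm sum_distrib_left)
    also have "\<dots> \<le> inverse ?l ^ m * ?l ^ m"
      using trace_le_trace_bound[OF that] by (intro mult_left_mono) auto
    finally show ?thesis using inv by simp
  qed
  obtain m where m: "m \<in> {1..?n}" "?l = sroot m (trace (matpow A m))"
    unfolding trace_bound_def
    using sum_attained_semifield[of "{1..?n}" "\<lambda>m. sroot m (trace (matpow A m))"]
    by (auto simp: Suc_le_eq)
  then have "?l ^ m = trace (matpow A m)" using sroot_power[of m] by auto
  then obtain c where c: "matpow A m $ c $ c = ?l ^ m"
    unfolding trace_def using sum_attained_semifield[of UNIV "\<lambda>c. matpow A m $ c $ c"] by auto
  then have crit: "matpow B m $ c $ c = 1" using Bm inv by simp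
  define y where "y = (\<chi> i. asterate B $ i $ c)"
  have y: "y $ i = (\<Sum>k<?n. matpow B k $ i $ c)" for i
    by (simp add: y_def asterate_def)
  have By: "(B *v y) $ i = (\<Sum>k<?n. matpow B (Suc k) $ i $ c)" for i
    unfolding matpow_Suc_left
    by (simp add: matrix_vector_mult_def y matrix_matrix_mult_def sum_distrib_left) (rule sum.swap)
  have mem: "k < ?n \<Longrightarrow> matpow B k $ i $ c \<le> y $ i"
    and mem': "k < ?n \<Longrightarrow> matpow B (Suc k) $ i $ c \<le> (B *v y) $ i" for k i
    unfolding y By
    by (rule member_le_sum_semifield[where f = "\<lambda>k. matpow B k $ i $ c"], auto)
       (rule member_le_sum_semifield[where f = "\<lambda>k. (matpow B k ** B) $ i $ c"], auto)
  have "(B *v y) $ i \<le> y $ i" for i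
    unfolding By
  proof (subst sum_le_iff_semifield, simp, intro ballI)
    fix k assume "k \<in> {..<?n}"
    then consider "Suc k < ?n" | "Suc k = ?n" by fastforce
    then show "matpow B (Suc k) $ i $ c \<le> y $ i"
    proof cases
      case 1 then show ?thesis by (rule mem)
    next
      case 2 then show ?thesis using matpow_reduce[OF tr, of i c] by (simp add: y_def)
    qed
  qed
  moreover have "y $ i \<le> (B *v y) $ i" for i
    unfolding y
  proof (subst sum_le_iff_semifield, simp, intro ballI)
    fix k assume k: "k \<in> {..<?n}"
    show "matpow B k $ i $ c \<le> (B *v y) $ i"
    proof (cases k)
      case (Suc k')
      then show ?thesis using mem'[of k'] k by simp
    next
      case 0
      show ?thesis
      proof (cases "i = c")
        case True
        have "m - 1 < ?n" "Suc (m - 1) = m" using m(1) by auto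
        then have "1 \<le> (B *v y) $ c" using mem'[of "m - 1" c] crit by metis
        then show ?thesis using True 0 by (simp add: mat_def)
      next
        case False
        then show ?thesis using 0 by (simp add: mat_def)
      qed
    qed
  qed
  ultimately have eq: "B *v y = y" by (simp add: vec_eq_iff order.antisym)
  have "matpow B 0 $ c $ c \<le> y $ c" by (rule mem) simp
  then have "y $ c \<noteq> 0" by (auto simp: mat_def)
  then have "y \<noteq> 0" by (metis zero_index)
  moreover have "A *v y = ?l *s y"
  proof -
    have "A = ?l *ms B"
      using left_inverse_semifield[OF False]
      by (simp add: B_def smult_mat_def vec_eq_iff flip: mult.assoc) (simp add: mult.commute)
    then have "A *v y = ?l *s (B *v y)"
      by (simp add: smult_mat_def vec_eq_iff matrix_vector_mult_def sum_distrib_left mult.assoc)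
    then show ?thesis by (simp add: eq)
  qed
  ultimately show ?thesis unfolding eigenvalue_def by blast
qed

theorem spectral_radius_eq:
  fixes A :: "'a::radicable_linordered_idempotent_semifield ^ 'n ^ 'n"
  shows "spectral_radius A = (\<Sum>m=1..CARD('n). sroot m (trace (matpow A m)))"
    and "eigenvalue A (spectral_radius A)"
    and "eigenvalue A l \<Longrightarrow> l \<le> spectral_radius A"
proof -
  have *: "spectral_radius A = trace_bound A"
    unfolding spectral_radius_def
    by (rule Greatest_equality) (auto intro: eigenvalue_trace_bound eigenvalue_le_trace_bound)
  show "spectral_radius A = (\<Sum>m=1..CARD('n). sroot m (trace (matpow A m)))"
    unfolding * trace_bound_def ..
  show "eigenvalue A (spectral_radius A)" unfolding * by (rule eigenvalue_trace_bound)
  show "eigenvalue A l \<Longrightarrow> l \<le> spectral_radius A" unfolding * by (rule eigenvalue_le_trace_bound)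
qed

end

theory Submission
  imports Defs
begin

text \<open>
  For regular \<open>x\<close> and \<open>\<theta> \<noteq> 0\<close>, "\<open>x\<close> is feasible with objective at most \<open>\<theta>\<close>" is, apart from
  \<open>r \<le> \<theta>\<close>, a system of linear inequalities: inequalities of the form \<open>x\<^sup>- y \<le> \<theta>\<close> can be residuated
  to \<open>y \<le> \<theta> x\<close>, and \<open>x \<le> h\<close> can be written as \<open>h\<^sup>- x \<le> 1\<close>. With \<open>B = \<theta>\<inverse> A\<close>,
  \<open>b = \<theta>\<inverse> p \<oplus> g\<close> and \<open>c = \<theta>\<inverse> q\<^sup>- \<oplus> h\<^sup>-\<close> the system reads
  \<open>B x \<le> x\<close>, \<open>b \<le> x\<close>, \<open>c x \<le> 1\<close> (lemma \<open>feasible_objective_le_iff\<close>).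

  Such a system is easy to analyse. If \<open>x\<close> solves it, then \<open>B\<^sup>m x \<le> x\<close> for all \<open>m\<close>, so
  \<open>B\<^sup>m\<close> has diagonal entries at most \<open>1\<close> (that is, \<open>\<theta>\<close> is at least the spectral radius of \<open>A\<close>),
  and \<open>c B\<^sup>m b \<le> c B\<^sup>m x \<le> c x \<le> 1\<close>. Expanding the latter inequalities and taking roots turns
  these necessary conditions, together with \<open>r \<le> \<theta>\<close>, into a lower bound on \<open>\<theta>\<close>, and this bound is
  exactly \<open>\<mu>\<close> (lemma \<open>optimal_value_le_iff\<close>). The lower bound by the spectral radius holds without
  dividing by \<open>\<theta>\<close>, so \<open>\<lambda> > 0\<close> ensures that no feasible vector has objective \<open>0\<close>.

  Conversely, when the spectral radius of \<open>A\<close> is at most \<open>\<theta>\<close>, the Kleene star satisfies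
  \<open>B B\<^sup>\<ast> \<le> B\<^sup>\<ast>\<close>, so the solutions of \<open>B x \<le> x\<close> are precisely the vectors \<open>B\<^sup>\<ast> u\<close>. The other
  two inequalities then become \<open>b \<le> u \<le> (c B\<^sup>\<ast>)\<^sup>-\<close> (lemma \<open>linear_system_solutions\<close>). This interval
  is nonempty if and only if \<open>c B\<^sup>\<ast> b \<le> 1\<close>, which holds for \<open>\<theta> = \<mu>\<close>; so \<open>\<mu>\<close> is attained, and
  the solutions with \<open>\<theta> = \<mu>\<close> are the minimizers.
\<close>

section \<open>Inverses and roots\<close>

lemma inverse_neq_0_semifield:
  fixes x :: "'a::linordered_idempotent_semifield"
  assumes "x \<noteq> 0"
  shows "inverse x \<noteq> 0"
  using left_inverse_semifield[OF assms] by auto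

lemma inverse_inverse_semifield:
  fixes x :: "'a::linordered_idempotent_semifield"
  assumes "x \<noteq> 0"
  shows "inverse (inverse x) = x"
proof -
  have "inverse (inverse x) = inverse (inverse x) * (inverse x * x)"
    using left_inverse_semifield[OF assms] by simp
  also have "\<dots> = x"
    using left_inverse_semifield[OF inverse_neq_0_semifield[OF assms]] by (simp flip: mult.assoc)
  finally show ?thesis .
qed

lemma inverse_mult_le_iff:
  fixes x y z :: "'a::linordered_idempotent_semifield"
  assumes "x \<noteq> 0"
  shows "inverse x * y \<le> z \<longleftrightarrow> y \<le> x * z"
proof -
  have "inverse x * y * x = y"
    using left_inverse_semifield[OF assms] by (metis mult.assoc mult.commute mult_1_left)
  then show ?thesis
    using mult_le_cancel_right_semifield[OF assms, of "inverse x * y" z] by (simp add: mult.commute)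
qed

lemma inverse_power_mult_le_iff:
  fixes x y z :: "'a::linordered_idempotent_semifield"
  assumes "x \<noteq> 0"
  shows "inverse x ^ m * y \<le> z \<longleftrightarrow> y \<le> x ^ m * z"
  using assms
proof (induction m arbitrary: z)
  case (Suc m)
  have "inverse x ^ Suc m * y \<le> z \<longleftrightarrow> inverse x ^ m * y \<le> x * z"
    using inverse_mult_le_iff[OF Suc.prems] by (simp add: mult.assoc)
  then show ?case using Suc by (simp add: mult_ac)
qed simp

lemma sroot_le_iff:
  fixes x y :: "'a::radicable_linordered_idempotent_semifield"
  assumes "m > 0"
  shows "sroot m x \<le> y \<longleftrightarrow> x \<le> y ^ m"
  using power_le_iff_semifield[OF assms, of "sroot m x" y] by (simp add: sroot_power[OF assms])

section \<open>Vectors, matrices and residuation\<close>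

lemma vec_add_le_iff_semifield:
  fixes x y z :: "'a::linordered_idempotent_semifield ^ 'n"
  shows "x + y \<le> z \<longleftrightarrow> x \<le> z \<and> y \<le> z"
  by (auto simp: less_eq_vec_def add_le_iff_semifield)

lemma inverse_smult_le_iff:
  fixes x y :: "'a::linordered_idempotent_semifield ^ 'n"
  assumes "c \<noteq> 0"
  shows "inverse c *s x \<le> y \<longleftrightarrow> x \<le> c *s y"
  by (simp add: less_eq_vec_def inverse_mult_le_iff[OF assms])

lemma scalar_product_le_iff:
  fixes x y :: "'a::linordered_idempotent_semifield ^ 'n"
  shows "scalar_product y x \<le> c \<longleftrightarrow> (\<forall>i. y $ i * x $ i \<le> c)"
  by (simp add: scalar_product_def sum_le_iff_semifield)

lemma scalar_product_right_mono:
  fixes x x' y :: "'a::linordered_idempotent_semifield ^ 'n"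
  assumes "x \<le> x'"
  shows "scalar_product y x \<le> scalar_product y x'"
  unfolding scalar_product_def using assms
  by (intro sum_mono mult_left_mono) (auto simp: less_eq_vec_def)

lemma scalar_product_linear:
  fixes x y z :: "'a::comm_semiring_1 ^ 'n"
  shows "scalar_product (x + y) z = scalar_product x z + scalar_product y z"
    and "scalar_product z (x + y) = scalar_product z x + scalar_product z y"
    and "scalar_product (c *s x) z = c * scalar_product x z"
    and "scalar_product z (c *s x) = c * scalar_product z x"
  by (simp_all add: scalar_product_def algebra_simps sum.distrib sum_distrib_left)

lemma scalar_product_vector_matrix_mult:
  fixes A :: "'a::comm_semiring_1 ^ 'n ^ 'm"
  shows "scalar_product (y v* A) x = scalar_product y (A *v x)"
  unfolding scalar_product_def vector_matrix_mult_def matrix_vector_mult_def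
  by (simp add: sum_distrib_left sum_distrib_right mult.assoc) (rule sum.swap)

lemma matrix_vector_mult_mono:
  fixes A :: "'a::linordered_idempotent_semifield ^ 'n ^ 'm"
  assumes "x \<le> y"
  shows "A *v x \<le> A *v y"
  unfolding matrix_vector_mult_def less_eq_vec_def using assms
  by (auto intro!: sum_mono mult_left_mono simp: less_eq_vec_def)

lemma matrix_vector_mult_smult:
  fixes A :: "'a::comm_semiring_1 ^ 'n ^ 'm"
  shows "A *v (c *s x) = c *s (A *v x)"
  by (simp add: vec_eq_iff matrix_vector_mult_def sum_distrib_left mult_ac)

lemma smult_mat_vector_mult:
  fixes A :: "'a::comm_semiring_1 ^ 'n ^ 'm"
  shows "(c *ms A) *v x = c *s (A *v x)"
  by (simp add: smult_mat_def vec_eq_iff matrix_vector_mult_def sum_distrib_left mult.assoc)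

lemma regular_conj_vec:
  assumes "regular x"
  shows "regular (x\<^sup>-)"
  using assms by (simp add: regular_def conj_vec_def inverse_neq_0_semifield)

lemma conj_vec_conj_vec:
  assumes "regular x"
  shows "(x\<^sup>-)\<^sup>- = x"
  using assms
  by (simp add: regular_def conj_vec_def vec_eq_iff inverse_neq_0_semifield inverse_inverse_semifield)

lemma regular_mono:
  fixes x y :: "'a::linordered_idempotent_semifield ^ 'n"
  assumes "regular x" "x \<le> y"
  shows "regular y"
  using assms unfolding regular_def less_eq_vec_def by (metis le_zero_eq)

text \<open>
  Multiplication by a nonzero scalar is an order automorphism, so the inverses can be moved to the
  other side entry by entry. The bounds involving \<open>x\<^sup>-\<close> in the objective, the constraint \<open>x \<le> h\<close> and
  the upper bound on \<open>u\<close> are all turned into linear inequalities in this way.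
\<close>

lemma scalar_product_conj_vec_le_iff:
  assumes "regular x"
  shows "scalar_product (x\<^sup>-) y \<le> c \<longleftrightarrow> y \<le> c *s x"
  using assms
  by (simp add: regular_def scalar_product_le_iff conj_vec_def less_eq_vec_def
      inverse_mult_le_iff mult.commute[of c])

lemma le_conj_vec_iff:
  assumes "regular y"
  shows "x \<le> y\<^sup>- \<longleftrightarrow> scalar_product y x \<le> 1"
  using scalar_product_conj_vec_le_iff[OF regular_conj_vec[OF assms], of x 1]
  by (simp add: conj_vec_conj_vec[OF assms])

section \<open>Vectors that a matrix does not increase\<close>

lemma matpow_mult_le:
  fixes A :: "'a::linordered_idempotent_semifield ^ 'n ^ 'n"
  assumes "A *v x \<le> c *s x"
  shows "matpow A m *v x \<le> c ^ m *s x"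
proof (induction m)
  case (Suc m)
  have "matpow A (Suc m) *v x = matpow A m *v (A *v x)"
    by (simp add: matrix_vector_mul_assoc)
  also have "\<dots> \<le> matpow A m *v (c *s x)"
    by (rule matrix_vector_mult_mono[OF assms])
  also have "\<dots> \<le> c *s (c ^ m *s x)"
    using Suc by (simp add: matrix_vector_mult_smult less_eq_vec_def mult_left_mono mult.assoc)
  finally show ?case by (simp add: vector_smult_assoc)
qed simp

lemma spectral_radius_le_iff:
  fixes A :: "'a::radicable_linordered_idempotent_semifield ^ 'n ^ 'n"
  shows "spectral_radius A \<le> c \<longleftrightarrow> (\<forall>m\<in>{1..CARD('n)}. trace (matpow A m) \<le> c ^ m)"
  unfolding spectral_radius_eq(1) by (simp add: sum_le_iff_semifield sroot_le_iff)

text \<open>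
  The diagonal entry \<open>a\<close> of \<open>A\<^sup>m\<close> at \<open>i\<close> satisfies \<open>a x\<^sub>i \<le> (A\<^sup>m x)\<^sub>i \<le> c\<^sup>m x\<^sub>i\<close>, and \<open>x\<^sub>i\<close> cancels.
  The case \<open>c = 0\<close> matters: it shows that the objective cannot vanish if the spectral radius is
  positive.
\<close>

lemma spectral_radius_le:
  fixes A :: "'a::radicable_linordered_idempotent_semifield ^ 'n ^ 'n"
  assumes "regular x" "A *v x \<le> c *s x"
  shows "spectral_radius A \<le> c"
  unfolding spectral_radius_le_iff
proof
  fix m
  have "matpow A m $ i $ i \<le> c ^ m" for i
  proof -
    have "matpow A m $ i $ i * x $ i \<le> (matpow A m *v x) $ i"
      unfolding matrix_vector_mult_def
      by (simp, rule member_le_sum_semifield[where f = "\<lambda>j. matpow A m $ i $ j * x $ j"]) auto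
    also have "\<dots> \<le> c ^ m * x $ i"
      using matpow_mult_le[OF assms(2), of m] by (simp add: less_eq_vec_def)
    finally show ?thesis
      using assms(1) by (simp add: regular_def mult_le_cancel_right_semifield)
  qed
  then show "trace (matpow A m) \<le> c ^ m"
    by (simp add: trace_def sum_le_iff_semifield)
qed

lemma trace_matpow_scaled_le_one:
  fixes A :: "'a::radicable_linordered_idempotent_semifield ^ 'n ^ 'n"
  assumes "c \<noteq> 0" "spectral_radius A \<le> c" "m \<in> {1..CARD('n)}"
  shows "trace (matpow (inverse c *ms A) m) \<le> 1"
proof -
  have "trace (matpow (inverse c *ms A) m) = inverse c ^ m * trace (matpow A m)"
    by (simp add: matpow_smult trace_def sum_distrib_left) (simp add: smult_mat_def)
  then show ?thesis
    using assms by (simp add: inverse_power_mult_le_iff spectral_radius_le_iff)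
qed

section \<open>The Kleene star and linear inequalities\<close>

lemma asterate_mult_nth:
  fixes B :: "'a::linordered_idempotent_semifield ^ 'n ^ 'n"
  shows "(asterate B *v u) $ i = (\<Sum>m<CARD('n). (matpow B m *v u) $ i)"
  unfolding asterate_def matrix_vector_mult_def
  by (simp add: sum_distrib_right) (rule sum.swap)

lemma asterate_mult_le_iff:
  fixes B :: "'a::linordered_idempotent_semifield ^ 'n ^ 'n"
  shows "asterate B *v u \<le> x \<longleftrightarrow> (\<forall>m<CARD('n). matpow B m *v u \<le> x)"
  by (auto simp: less_eq_vec_def asterate_mult_nth sum_le_iff_semifield)

lemma scalar_product_asterate_le_iff:
  fixes B :: "'a::linordered_idempotent_semifield ^ 'n ^ 'n"
  shows "scalar_product c (asterate B *v u) \<le> d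
     \<longleftrightarrow> (\<forall>m<CARD('n). scalar_product c (matpow B m *v u) \<le> d)"
  by (auto simp: scalar_product_le_iff asterate_mult_nth sum_distrib_left sum_le_iff_semifield)

lemma le_asterate_mult:
  fixes B :: "'a::linordered_idempotent_semifield ^ 'n ^ 'n"
  shows "u \<le> asterate B *v u"
proof -
  have "matpow B 0 *v u \<le> asterate B *v u"
    using asterate_mult_le_iff[of B u "asterate B *v u"] by (metis order.refl zero_less_card_finite)
  then show ?thesis by simp
qed

lemma regular_mult_asterate:
  fixes B :: "'a::linordered_idempotent_semifield ^ 'n ^ 'n"
  assumes "regular c"
  shows "regular (c v* asterate B)"
proof (rule regular_mono[OF assms])
  have "1 \<le> asterate B $ i $ i" for i
    unfolding asterate_def
    using member_le_sum_semifield[of "{..<CARD('n)}" 0 "\<lambda>m. matpow B m $ i $ i"]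
    by (simp add: mat_def)
  then have "c $ i \<le> c $ i * asterate B $ i $ i" for i
    using mult_left_mono[of 1 "asterate B $ i $ i" "c $ i"] by simp
  also have "c $ i * asterate B $ i $ i \<le> (c v* asterate B) $ i" for i
    unfolding vector_matrix_mult_def
    by (simp, rule member_le_sum_semifield[where f = "\<lambda>j. c $ j * asterate B $ j $ i"]) auto
  finally show "c \<le> c v* asterate B" by (simp add: less_eq_vec_def)
qed

lemma asterate_mult_eq:
  fixes B :: "'a::linordered_idempotent_semifield ^ 'n ^ 'n"
  assumes "B *v x \<le> x"
  shows "asterate B *v x = x"
proof (rule order.antisym)
  show "asterate B *v x \<le> x"
    unfolding asterate_mult_le_iff using matpow_mult_le[of B x 1] assms by simp
qed (rule le_asterate_mult)

text \<open>
  \<open>B B\<^sup>\<ast>\<close> has the summands \<open>B, \<dots>, B\<^sup>n\<close>. All but the last occur in \<open>B\<^sup>\<ast>\<close>, and the last one is dominated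
  by \<open>B\<^sup>\<ast>\<close> because a walk of length \<open>n\<close> contains a cycle, whose weight is at most \<open>1\<close>.
\<close>

lemma mult_asterate_mult_le:
  fixes B :: "'a::linordered_idempotent_semifield ^ 'n ^ 'n"
  assumes tr: "\<And>m. m \<in> {1..CARD('n)} \<Longrightarrow> trace (matpow B m) \<le> 1"
  shows "B *v (asterate B *v u) \<le> asterate B *v u"
proof -
  let ?n = "CARD('n)"
  have step: "matpow B (Suc m) *v u \<le> asterate B *v u" if "m < ?n" for m
  proof (cases "Suc m = ?n")
    case True
    have "matpow B ?n $ i $ j * u $ j \<le> asterate B $ i $ j * u $ j" for i j
      by (rule mult_right_mono[OF matpow_reduce[OF tr]]) auto
    then show ?thesis
      unfolding True matrix_vector_mult_def by (simp add: less_eq_vec_def sum_mono)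
  next
    case False
    then show ?thesis
      using asterate_mult_le_iff[of B u "asterate B *v u"] that by (metis order.refl Suc_lessI)
  qed
  have "B *v (asterate B *v u) = (\<Sum>m<?n. matpow B (Suc m) *v u)"
  proof -
    have "asterate B *v u = (\<Sum>m<?n. matpow B m *v u)"
      by (simp add: vec_eq_iff asterate_mult_nth)
    moreover have "B *v (\<Sum>m<k. matpow B m *v u) = (\<Sum>m<k. matpow B (Suc m) *v u)" for k
      by (induction k)
        (simp_all add: matrix_vector_right_distrib matrix_vector_mul_assoc flip: matpow_Suc_left)
    ultimately show ?thesis by simp
  qed
  then show ?thesis
    using step by (simp add: less_eq_vec_def sum_le_iff_semifield)
qed

text \<open>
  In one direction \<open>u = x\<close> works, as \<open>B\<^sup>\<ast> x = x\<close>. Conversely \<open>x = B\<^sup>\<ast> u\<close> satisfies \<open>B x \<le> x\<close> by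
  \<open>B B\<^sup>\<ast> \<le> B\<^sup>\<ast>\<close>, it inherits \<open>b \<le> x\<close> from \<open>u \<le> B\<^sup>\<ast> u\<close>, and \<open>c x \<le> 1\<close> is the residuated form of the upper bound on \<open>u\<close>.
\<close>

lemma linear_system_solutions:
  fixes B :: "'a::linordered_idempotent_semifield ^ 'n ^ 'n"
  assumes tr: "\<And>m. m \<in> {1..CARD('n)} \<Longrightarrow> trace (matpow B m) \<le> 1"
    and c: "regular c"
  shows "B *v x \<le> x \<and> b \<le> x \<and> scalar_product c x \<le> 1
     \<longleftrightarrow> (\<exists>u. x = asterate B *v u \<and> b \<le> u \<and> u \<le> (c v* asterate B)\<^sup>-)"
proof -
  have upper: "u \<le> (c v* asterate B)\<^sup>- \<longleftrightarrow> scalar_product c (asterate B *v u) \<le> 1" for u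
    by (simp add: le_conj_vec_iff regular_mult_asterate[OF c] scalar_product_vector_matrix_mult)
  show ?thesis
  proof
    assume x: "B *v x \<le> x \<and> b \<le> x \<and> scalar_product c x \<le> 1"
    then show "\<exists>u. x = asterate B *v u \<and> b \<le> u \<and> u \<le> (c v* asterate B)\<^sup>-"
      unfolding upper by (intro exI[of _ x]) (simp add: asterate_mult_eq)
  next
    assume "\<exists>u. x = asterate B *v u \<and> b \<le> u \<and> u \<le> (c v* asterate B)\<^sup>-"
    then obtain u where u: "x = asterate B *v u" "b \<le> u" "scalar_product c x \<le> 1"
      unfolding upper by blast
    have "b \<le> x" using u(2) le_asterate_mult[of u B] unfolding u(1) by (rule order.trans)
    moreover have "B *v x \<le> x" unfolding u(1) by (rule mult_asterate_mult_le[OF tr])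
    ultimately show "B *v x \<le> x \<and> b \<le> x \<and> scalar_product c x \<le> 1" using u(3) by blast
  qed
qed

text \<open>The largest admissible \<open>u\<close> is regular, so the solution that it generates is regular too.\<close>

lemma linear_system_solvable:
  fixes B :: "'a::linordered_idempotent_semifield ^ 'n ^ 'n"
  assumes tr: "\<And>m. m \<in> {1..CARD('n)} \<Longrightarrow> trace (matpow B m) \<le> 1"
    and c: "regular c"
    and cb: "\<And>m. m < CARD('n) \<Longrightarrow> scalar_product c (matpow B m *v b) \<le> 1"
  shows "\<exists>x. regular x \<and> B *v x \<le> x \<and> b \<le> x \<and> scalar_product c x \<le> 1"
proof -
  let ?u = "(c v* asterate B)\<^sup>-"
  have "regular (asterate B *v ?u)"
    using regular_mono[OF regular_conj_vec[OF regular_mult_asterate[OF c]] le_asterate_mult] .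
  moreover have "b \<le> ?u"
    using cb by (simp add: le_conj_vec_iff regular_mult_asterate[OF c]
        scalar_product_vector_matrix_mult scalar_product_asterate_le_iff)
  ultimately show ?thesis
    using linear_system_solutions[OF tr c, of "asterate B *v ?u" b] by blast
qed

lemma linear_system_necessary:
  fixes B :: "'a::linordered_idempotent_semifield ^ 'n ^ 'n"
  assumes "B *v x \<le> x" "b \<le> x" "scalar_product c x \<le> 1"
  shows "scalar_product c (matpow B m *v b) \<le> 1"
proof -
  have "matpow B m *v b \<le> matpow B m *v x"
    by (rule matrix_vector_mult_mono[OF assms(2)])
  also have "\<dots> \<le> x"
    using matpow_mult_le[of B x 1 m] assms(1) by simp
  finally show ?thesis
    using scalar_product_right_mono assms(3) order.trans by blast
qed

section \<open>Sublevel sets of the objective\<close>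

lemma objective_le_iff:
  fixes A :: "'a::linordered_idempotent_semifield ^ 'n ^ 'n"
  assumes "regular x"
  shows "objective A p q r x \<le> c
     \<longleftrightarrow> A *v x \<le> c *s x \<and> p \<le> c *s x \<and> scalar_product (q\<^sup>-) x \<le> c \<and> r \<le> c"
  by (simp add: objective_def add_le_iff_semifield scalar_product_vector_matrix_mult
      scalar_product_conj_vec_le_iff[OF assms])

lemma feasible_objective_le_iff:
  fixes A :: "'a::linordered_idempotent_semifield ^ 'n ^ 'n"
  assumes "regular x" "regular h" "c \<noteq> 0"
  shows "feasible g h x \<and> objective A p q r x \<le> c
     \<longleftrightarrow> (inverse c *ms A) *v x \<le> x \<and> inverse c *s p + g \<le> x
       \<and> scalar_product (inverse c *s q\<^sup>- + h\<^sup>-) x \<le> 1 \<and> r \<le> c"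
proof -
  have "x \<le> h \<longleftrightarrow> scalar_product (h\<^sup>-) x \<le> 1"
    using scalar_product_conj_vec_le_iff[OF assms(2), of x 1] by simp
  then show ?thesis
    using assms
    by (auto simp: feasible_def objective_le_iff smult_mat_vector_mult inverse_smult_le_iff
        vec_add_le_iff_semifield scalar_product_linear add_le_iff_semifield inverse_mult_le_iff)
qed

section \<open>The optimal value\<close>

definition optimal_value ::
  "'a::radicable_linordered_idempotent_semifield ^ 'n ^ 'n \<Rightarrow> 'a ^ 'n \<Rightarrow> 'a ^ 'n \<Rightarrow> 'a ^ 'n \<Rightarrow> 'a ^ 'n
    \<Rightarrow> 'a \<Rightarrow> 'a" where
  "optimal_value A p q g h r = spectral_radius A
        + (\<Sum>m=0..CARD('n) - 1. sroot (m + 2) (scalar_product (q\<^sup>- v* matpow A m) p))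
        + (\<Sum>m=0..CARD('n) - 1. sroot (m + 1)
             (scalar_product (q\<^sup>- v* matpow A m) g + scalar_product (h\<^sup>- v* matpow A m) p))
        + (\<Sum>m=1..CARD('n) - 1. sroot m (scalar_product (h\<^sup>- v* matpow A m) g))
        + r"

text \<open>
  Each of the four products of a summand on the left with one on the right is of degree \<open>m\<close>,
  \<open>m + 1\<close> or \<open>m + 2\<close> in \<open>c\<inverse>\<close>; these degrees are the orders of the roots in \<open>\<mu>\<close>.
\<close>

lemma scaled_scalar_product_le_one_iff:
  fixes A :: "'a::linordered_idempotent_semifield ^ 'n ^ 'n"
  assumes "c \<noteq> 0"
  shows "scalar_product (inverse c *s y + z) (matpow (inverse c *ms A) m *v (inverse c *s p + g)) \<le> 1
     \<longleftrightarrow> scalar_product (y v* matpow A m) p \<le> c ^ (m + 2)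
       \<and> scalar_product (y v* matpow A m) g \<le> c ^ (m + 1)
       \<and> scalar_product (z v* matpow A m) p \<le> c ^ (m + 1)
       \<and> scalar_product (z v* matpow A m) g \<le> c ^ m"
proof -
  let ?s = "\<lambda>y p. scalar_product (y v* matpow A m) p"
  have "scalar_product (inverse c *s y + z) (matpow (inverse c *ms A) m *v (inverse c *s p + g))
      = inverse c ^ (m + 2) * ?s y p + inverse c ^ (m + 1) * ?s y g
      + (inverse c ^ (m + 1) * ?s z p + inverse c ^ m * ?s z g)"
    by (simp add: scalar_product_linear matpow_smult smult_mat_vector_mult matrix_vector_mult_smult
        matrix_vector_right_distrib vector_add_ldistrib scalar_product_vector_matrix_mult
        distrib_left mult_ac add_ac)
  then show ?thesis
    using inverse_power_mult_le_iff[OF assms, of _ _ 1]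
    by (simp only: add_le_iff_semifield mult_1_right conj_assoc)
qed

text \<open>
  The condition for \<open>m = 0\<close> on \<open>h\<^sup>- A\<^sup>m g\<close> has no root and hence no term in \<open>\<mu>\<close>; it is the
  hypothesis that the box \<open>g \<le> x \<le> h\<close> is consistent.
\<close>

lemma optimal_value_le_iff:
  fixes A :: "'a::radicable_linordered_idempotent_semifield ^ 'n ^ 'n"
  assumes "c \<noteq> 0" and hg: "scalar_product (h\<^sup>-) g \<le> 1"
  shows "optimal_value A p q g h r \<le> c
     \<longleftrightarrow> spectral_radius A \<le> c \<and> r \<le> c
       \<and> (\<forall>m<CARD('n). scalar_product (inverse c *s q\<^sup>- + h\<^sup>-)
             (matpow (inverse c *ms A) m *v (inverse c *s p + g)) \<le> 1)"
proof -
  have range0: "m \<in> {0..CARD('n) - 1} \<longleftrightarrow> m < CARD('n)"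
    and range1: "m \<in> {1..CARD('n) - 1} \<longleftrightarrow> m < CARD('n) \<and> m \<noteq> 0" for m
    using zero_less_card_finite[where 'a = 'n] by (simp_all, linarith+)
  have hg0: "scalar_product (h\<^sup>- v* matpow A 0) g \<le> c ^ 0"
    using hg by simp
  have "optimal_value A p q g h r \<le> c
    \<longleftrightarrow> spectral_radius A \<le> c \<and> r \<le> c
      \<and> (\<forall>m\<in>{0..CARD('n) - 1}. scalar_product (q\<^sup>- v* matpow A m) p \<le> c ^ (m + 2))
      \<and> (\<forall>m\<in>{0..CARD('n) - 1}. scalar_product (q\<^sup>- v* matpow A m) g \<le> c ^ (m + 1)
           \<and> scalar_product (h\<^sup>- v* matpow A m) p \<le> c ^ (m + 1))
      \<and> (\<forall>m\<in>{1..CARD('n) - 1}. scalar_product (h\<^sup>- v* matpow A m) g \<le> c ^ m)"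
    unfolding optimal_value_def
    by (auto simp: add_le_iff_semifield sum_le_iff_semifield sroot_le_iff simp del: power_Suc)
  then show ?thesis
    unfolding Ball_def range0 range1 scaled_scalar_product_le_one_iff[OF assms(1)]
    using hg0 by metis
qed

section \<open>Minimum and minimizers\<close>

theorem theorem18:
  fixes A :: "'a::radicable_linordered_idempotent_semifield ^ 'n ^ 'n"
    and p q g h :: "'a ^ 'n"
    and r lam mu :: 'a
  assumes lam: "lam = spectral_radius A" "lam > 0"
    and q: "regular q"
    and h: "regular h"
    and hg: "scalar_product (h\<^sup>-) g \<le> 1"
    and mu: "mu = lam
        + (\<Sum>m=0..CARD('n) - 1. sroot (m + 2) (scalar_product (q\<^sup>- v* matpow A m) p))
        + (\<Sum>m=0..CARD('n) - 1. sroot (m + 1)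
             (scalar_product (q\<^sup>- v* matpow A m) g + scalar_product (h\<^sup>- v* matpow A m) p))
        + (\<Sum>m=1..CARD('n) - 1. sroot m (scalar_product (h\<^sup>- v* matpow A m) g))
        + r"
  shows "(\<exists>x. feasible g h x \<and> objective A p q r x = mu)
       \<and> (\<forall>x. feasible g h x \<longrightarrow> mu \<le> objective A p q r x)
       \<and> (\<forall>x. regular x \<longrightarrow>
            ((feasible g h x \<and> objective A p q r x = mu) \<longleftrightarrow>
             (\<exists>u. x = asterate (inverse mu *ms A) *v u
                \<and> inverse mu *s p + g \<le> u
                \<and> u \<le> ((inverse mu *s q\<^sup>- + h\<^sup>-) v* asterate (inverse mu *ms A))\<^sup>-)))"
proof -
  let ?B = "inverse mu *ms A" and ?b = "inverse mu *s p + g" and ?c = "inverse mu *s q\<^sup>- + h\<^sup>-"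
  have mu_opt: "mu = optimal_value A p q g h r"
    unfolding mu lam(1) optimal_value_def ..
  have "lam \<le> mu"
    unfolding mu by (simp add: add_eq_max le_max_iff_disj)
  then have mu0: "mu \<noteq> 0" using lam(2) by auto
  have conds: "spectral_radius A \<le> mu" "r \<le> mu"
    "\<And>m. m < CARD('n) \<Longrightarrow> scalar_product ?c (matpow ?B m *v ?b) \<le> 1"
    using optimal_value_le_iff[OF mu0 hg, of A p q r] unfolding mu_opt[symmetric] by auto
  have c: "regular ?c"
    by (rule regular_mono[OF regular_conj_vec[OF h]]) (simp add: less_eq_vec_def add_eq_max)
  note tr = trace_matpow_scaled_le_one[OF mu0 conds(1)]
  have lower: "mu \<le> objective A p q r x" if x: "feasible g h x" for x
  proof -
    let ?t = "objective A p q r x"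
    have reg: "regular x" using x by (simp add: feasible_def)
    have sr: "spectral_radius A \<le> ?t"
      using objective_le_iff[OF reg, of A p q r ?t] spectral_radius_le[OF reg] by blast
    then have t0: "?t \<noteq> 0" using lam by auto
    have "(inverse ?t *ms A) *v x \<le> x" "inverse ?t *s p + g \<le> x"
      "scalar_product (inverse ?t *s q\<^sup>- + h\<^sup>-) x \<le> 1" "r \<le> ?t"
      using feasible_objective_le_iff[OF reg h t0, of g A p q r] x by auto
    then show ?thesis
      unfolding mu_opt optimal_value_le_iff[OF t0 hg] using sr linear_system_necessary by blast
  qed
  have minimizer_iff: "feasible g h x \<and> objective A p q r x = mu
      \<longleftrightarrow> ?B *v x \<le> x \<and> ?b \<le> x \<and> scalar_product ?c x \<le> 1" if "regular x" for x
    using feasible_objective_le_iff[OF that h mu0, of g A p q r] lower[of x] conds(2)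
    by (metis order.antisym order.refl)
  show ?thesis
  proof (intro conjI allI impI)
    show "\<exists>x. feasible g h x \<and> objective A p q r x = mu"
      using linear_system_solvable[OF tr c conds(3)] minimizer_iff by blast
  qed (use lower minimizer_iff linear_system_solutions[OF tr c] in auto)
qed

end
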